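(* Let $1\le m\le n$ and $k\ge 2$, and let $K_{m,n}$ be the complete bipartite graph with parts of sizes $m$ and $n$. Then $\Delta_k^t(K_{m,n})$ is shellable if and only if $m<k$. Furthermore, if $m<k\le n$ then $\Delta_k^t(K_{m,n})$ is contractible, and if $m=k=n$ then $\Delta_k^t(K_{m,n})$ is homotopy equivalent to the $0$-sphere. If $k>n$, $\Delta_k^t(K_{m,n})$ is the void complex and hence shellable.
   Context: For $k\ge 1$, the total $k$-cut complex $\Delta_k^t(G)$ of a graph $G$ is the simplicial complex on $V(G)$ whose facets are the complements $V(G)\setminus S$ of independent sets $S$ of size $k$ in $G$; it is the void complex (no faces) if there are none. A shelling of a simplicial complex is an ordering $F_1,\dots,F_t$ of its facets such that for each $j>1$, $(\bigcup_{i<j}\langle F_i\rangle)\cap\langle F_j\rangle$ is a complex all of whose facets have cardinality $|F_j|-1$, where $\langle F\rangle$ is the simplex generated by $F$; by convention the void complex is shellable. *)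

theory Defs
  imports "HOL-Analysis.Analysis" "Graph_Theory.Graph_Theory"
begin

text \<open>Undirected graphs are symmetric digraphs (\<open>graph\<close>), as for \<open>complete_bipartite_digraph\<close>.
  A simplicial complex is a downward closed set of finite sets, its faces; the void complex
  \<open>{}\<close> has no faces at all, as opposed to \<open>{{}}\<close>.\<close>

definition indep_set :: "('a, 'b) pre_digraph \<Rightarrow> 'a set \<Rightarrow> bool" where
  "indep_set G S \<longleftrightarrow> S \<subseteq> verts G \<and> (\<forall>u\<in>S. \<forall>v\<in>S. (u, v) \<notin> arcs_ends G)"

definition facets :: "'a set set \<Rightarrow> 'a set set" where
  "facets \<Delta> = {F \<in> \<Delta>. \<forall>F'\<in>\<Delta>. F \<subseteq> F' \<longrightarrow> F' = F}"

definition total_cut_complex :: "nat \<Rightarrow> ('a, 'b) pre_digraph \<Rightarrow> 'a set set" where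
  "total_cut_complex k G = (\<Union>S\<in>{S. indep_set G S \<and> card S = k}. Pow (verts G - S))"

lemma facets_total_cut_complex:
  assumes "finite (verts G)"
  shows "facets (total_cut_complex k G) = {verts G - S | S. indep_set G S \<and> card S = k}"
proof -
  have eq: "verts G - T = verts G - S"
    if "indep_set G S" "indep_set G T" "card S = card T" "verts G - S \<subseteq> verts G - T" for S T
  proof -
    have "T \<subseteq> S" "finite S"
      using that assms by (auto simp: indep_set_def intro: finite_subset)
    then show ?thesis
      using that(3) card_subset_eq[of S T] by simp
  qed
  show ?thesis
  proof (intro equalityI subsetI)
    fix F assume "F \<in> facets (total_cut_complex k G)"
    then have F: "F \<in> total_cut_complex k G"
      and max: "\<And>F'. F' \<in> total_cut_complex k G \<Longrightarrow> F \<subseteq> F' \<Longrightarrow> F' = F"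
      by (auto simp: facets_def)
    from F obtain S where S: "indep_set G S" "card S = k" "F \<subseteq> verts G - S"
      unfolding total_cut_complex_def by blast
    have "verts G - S \<in> total_cut_complex k G"
      using S(1,2) unfolding total_cut_complex_def by blast
    then have "verts G - S = F" using max S(3) by blast
    then show "F \<in> {verts G - S | S. indep_set G S \<and> card S = k}"
      using S(1,2) by blast
  next
    fix F assume "F \<in> {verts G - S | S. indep_set G S \<and> card S = k}"
    then obtain S where S: "F = verts G - S" "indep_set G S" "card S = k" by blast
    have mem: "F \<in> total_cut_complex k G"
      using S unfolding total_cut_complex_def by blast
    have "F' = F" if F': "F' \<in> total_cut_complex k G" "F \<subseteq> F'" for F'
    proof -
      obtain T where T: "indep_set G T" "card T = k" "F' \<subseteq> verts G - T"
        using F'(1) unfolding total_cut_complex_def by blast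
      have "verts G - S \<subseteq> verts G - T"
        using F'(2) S(1) T(3) by (metis order_trans)
      then have "verts G - T = F"
        using eq[OF S(2) T(1)] S(1,3) T(2) by simp
      then show ?thesis using F'(2) T(3) by blast
    qed
    with mem show "F \<in> facets (total_cut_complex k G)"
      by (simp add: facets_def)
  qed
qed

text \<open>Positions are counted from \<open>0\<close>. The empty list is a shelling of the void complex.\<close>

definition shelling :: "'a set set \<Rightarrow> 'a set list \<Rightarrow> bool" where
  "shelling \<Delta> Fs \<longleftrightarrow> distinct Fs \<and> set Fs = facets \<Delta> \<and>
     (\<forall>j. 0 < j \<and> j < length Fs \<longrightarrow>
        (\<forall>F \<in> facets ((\<Union>i<j. Pow (Fs ! i)) \<inter> Pow (Fs ! j)). Suc (card F) = card (Fs ! j)))"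

definition shellable :: "'a set set \<Rightarrow> bool" where
  "shellable \<Delta> \<longleftrightarrow> (\<exists>Fs. shelling \<Delta> Fs)"

text \<open>Points are given by barycentric coordinates, extended by \<open>0\<close>. For a finite complex the
  topology of pointwise convergence is the usual one on the realization.\<close>

definition geometric_realization :: "'a set set \<Rightarrow> ('a \<Rightarrow> real) topology" where
  "geometric_realization \<Delta> = subtopology (powertop_real UNIV)
     {x. (\<forall>v. 0 \<le> x v) \<and> {v. x v \<noteq> 0} \<in> \<Delta> \<and> (\<Sum>v | x v \<noteq> 0. x v) = 1}"

text \<open>The empty space satisfies \<open>contractible_space\<close> but is not homotopy equivalent to a point.\<close>

definition contractible_complex :: "'a set set \<Rightarrow> bool" where
  "contractible_complex \<Delta> \<longleftrightarrow>
     topspace (geometric_realization \<Delta>) \<noteq> {} \<and> contractible_space (geometric_realization \<Delta>)"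

end

theory Submission
  imports Defs
begin

text \<open>The independent \<open>k\<close>-sets of \<open>K\<^bsub>m,n\<^esub>\<close> are the \<open>k\<close>-subsets of the two parts \<open>U\<close> and \<open>V\<close>.

  If \<open>m < k\<close>, only the subsets \<open>S\<close> of \<open>V\<close> matter. Number the vertices of \<open>V\<close> and order the facets by
  the sum of the numbers in \<open>S\<close>, breaking ties arbitrarily: if \<open>S\<close> precedes \<open>T\<close>, some element of
  \<open>T - S\<close> can be exchanged for a smaller element of \<open>S - T\<close>, which gives a shelling. Every facet
  contains \<open>U\<close>, so the complex is a cone.

  If \<open>k \<le> m\<close>, the first facet of a putative shelling whose complement lies in the other part than that of
  the initial facet meets all earlier facets in sets that are \<open>k \<ge> 2\<close> elements smaller. If \<open>m = k = n\<close>,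
  the complex consists of the two disjoint simplices on \<open>U\<close> and \<open>V\<close>.\<close>

section \<open>Exchange criterion for shellability, and an obstruction to it\<close>

section \<open>Shellings\<close>

lemma shellable_void: "shellable {}"
  unfolding shellable_def shelling_def by (rule exI[of _ "[]"]) (simp add: facets_def)

text \<open>Sort the facets by \<open>w\<close>. If \<open>F\<close> precedes \<open>H\<close>, the
  exchange facet \<open>E\<close> has strictly smaller weight, so it precedes \<open>H\<close> too,
  and \<open>F \<inter> H\<close> lies in \<open>E \<inter> H\<close>, which is one element smaller
  than \<open>H\<close>. Hence every maximal face of the intersection is such an
  \<open>E \<inter> H\<close>. The exchange is assumed for \<open>w F \<le> w H\<close>, since
  facets of equal weight may come in either order.\<close>

lemma shellable_by_exchange:
  fixes w :: "'a set \<Rightarrow> nat"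
  assumes fin: "finite (facets \<Delta>)"
    and exch: "\<And>F H. F \<in> facets \<Delta> \<Longrightarrow> H \<in> facets \<Delta> \<Longrightarrow> F \<noteq> H \<Longrightarrow> w F \<le> w H \<Longrightarrow>
      \<exists>E \<in> facets \<Delta>. w E < w H \<and> F \<inter> H \<subseteq> E \<and> Suc (card (E \<inter> H)) = card H"
  shows "shellable \<Delta>"
proof -
  obtain xs where xs: "set xs = facets \<Delta>" "distinct xs"
    using finite_distinct_list[OF fin] by blast
  define Fs where "Fs = sort_key w xs"
  have set: "set Fs = facets \<Delta>" and dist: "distinct Fs" and sorted: "sorted (map w Fs)"
    using xs by (simp_all add: Fs_def)
  have mono: "w (Fs ! i) \<le> w (Fs ! j)" if "i \<le> j" "j < length Fs" for i j
    using sorted_nth_mono[OF sorted, of i j] that by simp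
  have "Suc (card F) = card (Fs ! j)"
    if j: "j < length Fs" and F: "F \<in> facets ((\<Union>i<j. Pow (Fs ! i)) \<inter> Pow (Fs ! j))" for j F
  proof -
    obtain i where i: "i < j" "F \<subseteq> Fs ! i" "F \<subseteq> Fs ! j"
      using F by (auto simp: facets_def)
    have "Fs ! i \<noteq> Fs ! j"
      using i(1) j dist by (simp add: nth_eq_iff_index_eq)
    moreover have "Fs ! i \<in> facets \<Delta>" "Fs ! j \<in> facets \<Delta>"
      using i(1) j unfolding set[symmetric] by simp_all
    ultimately obtain E where E: "E \<in> facets \<Delta>" "w E < w (Fs ! j)"
        "Fs ! i \<inter> Fs ! j \<subseteq> E" "Suc (card (E \<inter> Fs ! j)) = card (Fs ! j)"
      using exch mono i(1) j by (metis less_imp_le)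
    obtain l where l: "l < length Fs" "E = Fs ! l"
      using E(1) set by (metis in_set_conv_nth)
    \<comment> \<open>The strict inequality of weights places \<open>E\<close> before position
      \<open>j\<close>, whatever the order among ties.\<close>
    have "l < j"
      using mono[of j l] l E(2) by (meson leD not_le)
    then have "E \<inter> Fs ! j \<in> (\<Union>i<j. Pow (Fs ! i)) \<inter> Pow (Fs ! j)"
      using l(2) by blast
    moreover have "F \<subseteq> E \<inter> Fs ! j"
      using i E(3) by blast
    ultimately have "E \<inter> Fs ! j = F"
      using F by (simp add: facets_def)
    then show ?thesis using E(4) by simp
  qed
  then show ?thesis
    unfolding shellable_def shelling_def using set dist by blast
qed

text \<open>For \<open>k\<close> at most \<open>card V\<close>, these are the facets of the join of
  the simplex on \<open>W - V\<close> with a skeleton of the simplex on \<open>V\<close>.\<close>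

lemma shellable_complements_of_subsets:
  assumes W: "finite W" "V \<subseteq> W"
    and facets: "facets \<Delta> = {W - S | S. S \<subseteq> V \<and> card S = k}"
  shows "shellable \<Delta>"
proof -
  have finV: "finite V" using W finite_subset by blast
  obtain f :: "'a \<Rightarrow> nat" where f: "inj_on f V"
    using finite_imp_inj_to_nat_seg[OF finV] by blast
  \<comment> \<open>The weight must be a function of the facet: \<open>V - F\<close> recovers
    \<open>S\<close> from \<open>F = W - S\<close>.\<close>
  define w where "w F = sum f (V - F)" for F
  have wS: "w (W - S) = sum f S" if "S \<subseteq> V" for S
  proof -
    have "V - (W - S) = S" using that W by blast
    then show ?thesis by (simp add: w_def)
  qed
  show ?thesis
  proof (rule shellable_by_exchange[where w = w])
    have "facets \<Delta> \<subseteq> Pow W" unfolding facets by blast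
    then show "finite (facets \<Delta>)" using W(1) by (meson finite_Pow_iff finite_subset)
  next
    fix F H assume FH: "F \<in> facets \<Delta>" "H \<in> facets \<Delta>" "F \<noteq> H" "w F \<le> w H"
    obtain S T where S: "F = W - S" "S \<subseteq> V" "card S = k" and T: "H = W - T" "T \<subseteq> V" "card T = k"
      using FH(1,2) unfolding facets by blast
    have fin: "finite S" "finite T" using S T finV finite_subset by blast+
    have ST: "S \<noteq> T" using FH(3) S T by blast
    have card: "card (S - T) = card (T - S)"
      using fin S(3) T(3) by (simp add: card_Diff_subset_Int Int_commute)
    have ne: "T - S \<noteq> {}"
      using ST S(3) T(3) fin card_subset_eq[of S T] by blast
    \<comment> \<open>The common part \<open>S \<inter> T\<close> contributes equally to both
      weights and cancels.\<close>
    have le: "sum f (S - T) \<le> sum f (T - S)"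
      using FH(4) S T wS sum.Int_Diff[of S f T] sum.Int_Diff[of T f S] fin by (simp add: Int_commute)
    \<comment> \<open>Otherwise every label on \<open>T - S\<close> is below every label on
      \<open>S - T\<close>, by injectivity of \<open>f\<close>. A bijection between these nonempty
      sets of equal size then makes the first sum strictly smaller, against
      \<open>le\<close>.\<close>
    have "\<exists>a\<in>S - T. \<exists>b\<in>T - S. f a < f b"
    proof (rule ccontr)
      assume neg: "\<not> ?thesis"
      have lt: "f b < f a" if "a \<in> S - T" "b \<in> T - S" for a b
      proof -
        have "f a \<noteq> f b" using that S(2) T(2) f by (auto simp: inj_on_def)
        then show ?thesis using neg that by (meson linorder_neqE_nat)
      qed
      obtain h where h: "bij_betw h (T - S) (S - T)"
        using card fin finite_same_card_bij[of "T - S" "S - T"] by auto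
      have "sum f (T - S) < (\<Sum>b\<in>T - S. f (h b))"
        using fin ne lt bij_betwE[OF h] by (intro sum_strict_mono) auto
      also have "\<dots> = sum f (S - T)"
        using sum.reindex_bij_betw[OF h] .
      finally show False using le by simp
    qed
    then obtain a b where ab: "a \<in> S - T" "b \<in> T - S" "f a < f b" by blast
    \<comment> \<open>Trading \<open>b\<close> for the smaller \<open>a\<close> lowers the weight.
      The facet \<open>W - T'\<close> meets \<open>H\<close> in \<open>H - {a}\<close>, and it
      contains \<open>F \<inter> H\<close> because \<open>T'\<close> lies in
      \<open>S \<union> T\<close>.\<close>
    define T' where "T' = insert a (T - {b})"
    have "T' \<subseteq> V" using ab S(2) T(2) by (auto simp: T'_def)
    moreover have "card T' = k"
      using ab T(3) fin(2) card_Suc_Diff1[of T b] by (simp add: T'_def)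
    ultimately have T': "T' \<subseteq> V" "card T' = k" .
    have sumT: "sum f T = f b + sum f (T - {b})"
      using ab fin by (simp add: sum.remove)
    have sumT': "sum f T' = f a + sum f (T - {b})"
      using ab fin by (simp add: T'_def)
    have HE: "(W - T') \<inter> H = H - {a}" using ab by (auto simp: T'_def T)
    have "a \<in> H" "finite H" using ab S T W by auto
    then have "Suc (card ((W - T') \<inter> H)) = card H"
      unfolding HE by (metis card_Suc_Diff1)
    moreover have "w (W - T') < w H"
      using T' T wS sumT sumT' ab(3) by simp
    moreover have "F \<inter> H \<subseteq> W - T'" using ab by (auto simp: S T T'_def)
    moreover have "W - T' \<in> facets \<Delta>" unfolding facets using T' by blast
    ultimately show "\<exists>E \<in> facets \<Delta>. w E < w H \<and> F \<inter> H \<subseteq> E \<and> Suc (card (E \<inter> H)) = card H"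
      by blast
  qed
qed

text \<open>The hypothesis on \<open>Fs ! 0\<close> breaks the symmetry between \<open>A\<close> and
  \<open>B\<close>; the opposite start follows by exchanging their roles.\<close>

lemma shelling_disjoint_complements_contradiction:
  assumes sh: "shelling \<Delta> Fs" and W: "finite W" and k: "2 \<le> k"
    and AB: "A \<inter> B = {}" "A \<subseteq> W" "B \<subseteq> W"
    and facets: "facets \<Delta> = {W - S | S. (S \<subseteq> A \<or> S \<subseteq> B) \<and> card S = k}"
    and start: "Fs ! 0 \<in> {W - S | S. S \<subseteq> A \<and> card S = k}"
    and T: "T \<subseteq> B" "card T = k"
  shows False
proof -
  define \<A> where "\<A> = {W - S | S. S \<subseteq> A \<and> card S = k}"
  let ?P = "\<lambda>j. j < length Fs \<and> Fs ! j \<notin> \<A>"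
  have set: "set Fs = facets \<Delta>" using sh by (simp add: shelling_def)
  have "W - T \<notin> \<A>"
  proof
    assume "W - T \<in> \<A>"
    then obtain S where "W - T = W - S" "S \<subseteq> A" unfolding \<A>_def by blast
    then have "T = {}" using T(1) AB by blast
    then show False using T(2) k by simp
  qed
  moreover have "W - T \<in> set Fs" unfolding set facets using T by blast
  ultimately have ex: "\<exists>j. ?P j" by (auto simp: in_set_conv_nth)
  define j where "j = (LEAST j. ?P j)"
  have j: "?P j" unfolding j_def using ex by (rule LeastI_ex)
  have before: "Fs ! i \<in> \<A>" if "i < j" for i
    using not_less_Least[of i ?P] that j unfolding j_def[symmetric] by linarith
  have "Fs ! j \<in> facets \<Delta>" unfolding set[symmetric] using j by simp
  then obtain R where R: "Fs ! j = W - R" "R \<subseteq> B" "card R = k"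
    using j unfolding facets \<A>_def by blast
  have j0: "0 < j" using j start by (cases j) (auto simp: \<A>_def)
  have finR: "finite R" and RW: "R \<subseteq> W" using R(2) AB(3) W by (auto intro: finite_subset)
  \<comment> \<open>Disjointness of \<open>S\<close> and \<open>R\<close> makes the size of the
    intersection independent of \<open>S\<close>. The additive form avoids truncated
    subtraction.\<close>
  have meet: "card ((W - S) \<inter> (W - R)) + 2 * k = card W" if S: "S \<subseteq> A" "card S = k" for S
  proof -
    have finS: "finite S" and SW: "S \<subseteq> W" using S(1) AB(2) W by (auto intro: finite_subset)
    have "S \<inter> R = {}" using S(1) R(2) AB(1) by blast
    then have "card (S \<union> R) = 2 * k"
      using S(2) R(3) finS finR by (simp add: card_Un_disjoint)
    moreover have "(W - S) \<inter> (W - R) = W - (S \<union> R)" by blast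
    moreover have "card (W - (S \<union> R)) + card (S \<union> R) = card W"
      using finS finR SW RW W by (simp add: card_Diff_subset card_mono)
    ultimately show ?thesis by simp
  qed
  let ?I = "(\<Union>i<j. Pow (Fs ! i)) \<inter> Pow (Fs ! j)"
  obtain S where S: "Fs ! 0 = W - S" "S \<subseteq> A" "card S = k" using start by blast
  let ?F = "(W - S) \<inter> (W - R)"
  \<comment> \<open>All intersections of earlier facets with \<open>Fs ! j\<close> have the same
    size, so none properly contains another, and \<open>?F\<close> is a maximal face.\<close>
  have "F' = ?F" if F': "F' \<in> ?I" "?F \<subseteq> F'" for F'
  proof -
    obtain i where i: "i < j" "F' \<subseteq> Fs ! i" "F' \<subseteq> W - R" using F'(1) R(1) by auto
    obtain S' where S': "Fs ! i = W - S'" "S' \<subseteq> A" "card S' = k" using before[OF i(1)] unfolding \<A>_def by blast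
    have "?F \<subseteq> (W - S') \<inter> (W - R)" using F'(2) i S'(1) by blast
    moreover have "card ?F = card ((W - S') \<inter> (W - R))"
      using meet[OF S(2,3)] meet[OF S'(2,3)] by simp
    ultimately have "?F = (W - S') \<inter> (W - R)"
      using W by (intro card_subset_eq) auto
    then show ?thesis using F'(2) i S'(1) by blast
  qed
  moreover have "?F \<in> ?I" using j0 S(1) R(1) by blast
  ultimately have "?F \<in> facets ?I" unfolding facets_def by blast
  then have "Suc (card ?F) = card (Fs ! j)" using sh j j0 unfolding shelling_def by blast
  moreover have "card (Fs ! j) + k = card W"
    using R(1,3) RW W finR card_mono[OF W RW] by (simp add: card_Diff_subset)
  \<comment> \<open>The maximal face \<open>?F\<close> is \<open>k\<close> elements smaller than
    \<open>Fs ! j\<close>, whereas the shelling condition demands exactly one.\<close>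
  ultimately show False using meet[OF S(2,3)] k by linarith
qed

lemma not_shellable_disjoint_complements:
  assumes W: "finite W" and k: "2 \<le> k"
    and AB: "A \<inter> B = {}" "A \<subseteq> W" "B \<subseteq> W" "k \<le> card A" "k \<le> card B"
    and facets: "facets \<Delta> = {W - S | S. (S \<subseteq> A \<or> S \<subseteq> B) \<and> card S = k}"
  shows "\<not> shellable \<Delta>"
proof
  assume "shellable \<Delta>"
  then obtain Fs where sh: "shelling \<Delta> Fs" by (auto simp: shellable_def)
  obtain S T where S: "S \<subseteq> A" "card S = k" and T: "T \<subseteq> B" "card T = k"
    using AB(4,5) by (metis obtain_subset_with_card_n)
  have set: "set Fs = facets \<Delta>" using sh by (simp add: shelling_def)
  have "W - S \<in> set Fs" unfolding set facets using S by blast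
  then have "Fs ! 0 \<in> facets \<Delta>" using set by (metis length_pos_if_in_set nth_mem)
  then consider "Fs ! 0 \<in> {W - S | S. S \<subseteq> A \<and> card S = k}"
    | "Fs ! 0 \<in> {W - S | S. S \<subseteq> B \<and> card S = k}"
    unfolding facets by blast
  then show False
  proof cases
    case 1
    then show ?thesis
      using shelling_disjoint_complements_contradiction[OF sh W k AB(1-3) facets _ T] by blast
  next
    case 2
    have "B \<inter> A = {}" using AB(1) by blast
    moreover have "facets \<Delta> = {W - S | S. (S \<subseteq> B \<or> S \<subseteq> A) \<and> card S = k}"
      unfolding facets by blast
    ultimately show ?thesis
      using shelling_disjoint_complements_contradiction[OF sh W k _ AB(3,2) _ 2 S] by blast
  qed
qed

section \<open>Homotopy types of cones and of two disjoint simplices\<close>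

section \<open>Geometric realizations\<close>

definition abstract_simplicial_complex :: "'a set set \<Rightarrow> bool" where
  "abstract_simplicial_complex \<Delta> \<longleftrightarrow> (\<forall>\<sigma>\<in>\<Delta>. finite \<sigma> \<and> Pow \<sigma> \<subseteq> \<Delta>)"

text \<open>Any face containing the support may replace the support itself. Sums over a fixed face
  are linear in the point, which suits convex combinations, whose supports vary.\<close>

lemma topspace_geometric_realization:
  assumes "abstract_simplicial_complex \<Delta>"
  shows "topspace (geometric_realization \<Delta>) =
    {x. (\<forall>v. 0 \<le> x v) \<and> (\<exists>\<sigma>\<in>\<Delta>. (\<forall>v. v \<notin> \<sigma> \<longrightarrow> x v = 0) \<and> sum x \<sigma> = 1)}"
proof -
  have "{v. x v \<noteq> 0} \<in> \<Delta> \<and> (\<Sum>v | x v \<noteq> 0. x v) = 1 \<longleftrightarrow>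
    (\<exists>\<sigma>\<in>\<Delta>. (\<forall>v. v \<notin> \<sigma> \<longrightarrow> x v = 0) \<and> sum x \<sigma> = 1)" for x :: "'a \<Rightarrow> real"
  proof
    assume "\<exists>\<sigma>\<in>\<Delta>. (\<forall>v. v \<notin> \<sigma> \<longrightarrow> x v = 0) \<and> sum x \<sigma> = 1"
    then obtain \<sigma> where \<sigma>: "\<sigma> \<in> \<Delta>" "\<forall>v. v \<notin> \<sigma> \<longrightarrow> x v = 0" "sum x \<sigma> = 1" by blast
    then have sub: "{v. x v \<noteq> 0} \<subseteq> \<sigma>" by blast
    then have "(\<Sum>v | x v \<noteq> 0. x v) = sum x \<sigma>"
      using assms \<sigma>(1) by (intro sum.mono_neutral_left) (auto simp: abstract_simplicial_complex_def)
    then show "{v. x v \<noteq> 0} \<in> \<Delta> \<and> (\<Sum>v | x v \<noteq> 0. x v) = 1"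
      using assms \<sigma> sub unfolding abstract_simplicial_complex_def by auto
  qed auto
  then show ?thesis by (auto simp: geometric_realization_def)
qed

lemma continuous_map_geometric_realization_coordinate [continuous_intros]:
  "continuous_map (geometric_realization \<Delta>) euclideanreal (\<lambda>x. x v)"
  unfolding geometric_realization_def
  by (intro continuous_map_from_subtopology continuous_map_product_projection) simp

lemma continuous_map_into_geometric_realization:
  assumes "\<And>v. continuous_map X euclideanreal (\<lambda>x. f x v)"
    and "\<And>x. x \<in> topspace X \<Longrightarrow> f x \<in> topspace (geometric_realization \<Delta>)"
  shows "continuous_map X (geometric_realization \<Delta>) f"
  using assms unfolding geometric_realization_def
  by (auto simp: continuous_map_in_subtopology continuous_map_componentwise_UNIV)

text \<open>The straight-line homotopy works: at each \<open>x\<close> the segment from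
  \<open>f x\<close> to \<open>g x\<close> stays in the simplex of the common face, which is
  convex.\<close>

lemma homotopic_with_common_face:
  assumes \<Delta>: "abstract_simplicial_complex \<Delta>"
    and f: "continuous_map X (geometric_realization \<Delta>) f"
    and g: "continuous_map X (geometric_realization \<Delta>) g"
    and face: "\<And>x. x \<in> topspace X \<Longrightarrow> \<exists>\<sigma>\<in>\<Delta>. \<forall>v. v \<notin> \<sigma> \<longrightarrow> f x v = 0 \<and> g x v = 0"
  shows "homotopic_with (\<lambda>_. True) X (geometric_realization \<Delta>) f g"
proof -
  let ?I = "top_of_set {0..1::real}"
  let ?h = "\<lambda>(t::real, x) v. (1 - t) * f x v + t * g x v"
  have cf: "continuous_map X euclideanreal (\<lambda>x. f x v)" for v
    using continuous_map_compose[OF f continuous_map_geometric_realization_coordinate]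
    by (simp add: o_def)
  have cg: "continuous_map X euclideanreal (\<lambda>x. g x v)" for v
    using continuous_map_compose[OF g continuous_map_geometric_realization_coordinate]
    by (simp add: o_def)
  have "continuous_map (prod_topology ?I X) (geometric_realization \<Delta>) ?h"
  proof (rule continuous_map_into_geometric_realization)
    fix v
    have "continuous_map (prod_topology ?I X) euclideanreal (\<lambda>z. f (snd z) v)"
      "continuous_map (prod_topology ?I X) euclideanreal (\<lambda>z. g (snd z) v)"
      using continuous_map_compose[OF continuous_map_snd cf]
        continuous_map_compose[OF continuous_map_snd cg] by (auto simp: o_def)
    moreover have "continuous_map (prod_topology ?I X) euclideanreal fst"
      using continuous_map_fst continuous_map_into_fulltopology by blast
    ultimately show "continuous_map (prod_topology ?I X) euclideanreal (\<lambda>z. ?h z v)"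
      unfolding case_prod_unfold by (intro continuous_intros) auto
  next
    fix z assume z: "z \<in> topspace (prod_topology ?I X)"
    obtain t x where [simp]: "z = (t, x)" by force
    have t: "0 \<le> t" "t \<le> 1" and x: "x \<in> topspace X" using z by auto
    obtain \<sigma> where \<sigma>: "\<sigma> \<in> \<Delta>" "\<And>v. v \<notin> \<sigma> \<Longrightarrow> f x v = 0" "\<And>v. v \<notin> \<sigma> \<Longrightarrow> g x v = 0"
      using face[OF x] by blast
    have fin: "finite \<sigma>" using \<Delta> \<sigma>(1) by (simp add: abstract_simplicial_complex_def)
    have one: "sum y \<sigma> = 1" if y: "y \<in> topspace (geometric_realization \<Delta>)"
      and 0: "\<And>v. v \<notin> \<sigma> \<Longrightarrow> y v = 0" for y
    proof -
      have "sum y \<sigma> = (\<Sum>v | y v \<noteq> 0. y v)"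
        using fin 0 by (intro sum.mono_neutral_right) auto
      then show ?thesis using y by (simp add: geometric_realization_def)
    qed
    have F: "f x \<in> topspace (geometric_realization \<Delta>)" "g x \<in> topspace (geometric_realization \<Delta>)"
      using f g x continuous_map_image_subset_topspace by blast+
    have "\<forall>v. 0 \<le> f x v" "\<forall>v. 0 \<le> g x v"
      using F by (auto simp: geometric_realization_def)
    then have "\<forall>v. 0 \<le> ?h z v" using t by simp
    moreover have "sum (?h z) \<sigma> = 1"
      using one[OF F(1)] one[OF F(2)] \<sigma> by (simp add: sum.distrib flip: sum_distrib_left)
    moreover have "\<forall>v. v \<notin> \<sigma> \<longrightarrow> ?h z v = 0" using \<sigma>(2,3) by simp
    ultimately show "?h z \<in> topspace (geometric_realization \<Delta>)"
      unfolding topspace_geometric_realization[OF \<Delta>] using \<sigma>(1) by blast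
  qed
  then show ?thesis
    unfolding homotopic_with_def by (intro exI[of _ ?h]) auto
qed

lemma vertex_in_geometric_realization:
  assumes "abstract_simplicial_complex \<Delta>" "u \<in> \<sigma>" "\<sigma> \<in> \<Delta>"
  shows "indicat_real {u} \<in> topspace (geometric_realization \<Delta>)"
proof -
  have "{u} \<in> \<Delta>" using assms by (auto simp: abstract_simplicial_complex_def)
  then show ?thesis
    unfolding topspace_geometric_realization[OF assms(1)] by (auto simp: indicator_def intro!: bexI[of _ "{u}"])
qed

text \<open>A point carried by \<open>\<sigma>\<close> and the apex \<open>u\<close> both lie in the
  face \<open>insert u \<sigma>\<close>, so the identity is homotopic to the constant map at
  \<open>u\<close>.\<close>

lemma contractible_complex_cone:
  assumes \<Delta>: "abstract_simplicial_complex \<Delta>" and ne: "\<Delta> \<noteq> {}"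
    and cone: "\<And>\<sigma>. \<sigma> \<in> \<Delta> \<Longrightarrow> insert u \<sigma> \<in> \<Delta>"
  shows "contractible_complex \<Delta>"
proof -
  have u: "indicat_real {u} \<in> topspace (geometric_realization \<Delta>)"
    using vertex_in_geometric_realization[OF \<Delta>] ne cone by blast
  have "homotopic_with (\<lambda>_. True) (geometric_realization \<Delta>) (geometric_realization \<Delta>)
    id (\<lambda>_. indicat_real {u})"
  proof (rule homotopic_with_common_face[OF \<Delta>])
    fix x assume "x \<in> topspace (geometric_realization \<Delta>)"
    then obtain \<sigma> where "\<sigma> \<in> \<Delta>" "\<forall>v. v \<notin> \<sigma> \<longrightarrow> x v = 0"
      unfolding topspace_geometric_realization[OF \<Delta>] by blast
    then show "\<exists>\<sigma>\<in>\<Delta>. \<forall>v. v \<notin> \<sigma> \<longrightarrow> id x v = 0 \<and> indicat_real {u} v = 0"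
      using cone by (intro bexI[of _ "insert u \<sigma>"]) auto
  qed (use u in auto)
  then show ?thesis
    using u unfolding contractible_complex_def contractible_space_def by blast
qed

text \<open>Each simplex is collapsed to one of its vertices, and the two vertices form the sphere.
  The common face \<open>{}\<close> carries no point, so the simplices are disjoint in the
  realization.\<close>

lemma disjoint_simplices_homotopy_equivalent_nsphere_0:
  assumes fin: "finite A" "finite B" and ne: "A \<noteq> {}" "B \<noteq> {}" and disj: "A \<inter> B = {}"
  shows "geometric_realization (Pow A \<union> Pow B) homotopy_equivalent_space nsphere 0"
proof -
  let ?X = "geometric_realization (Pow A \<union> Pow B)"
  have \<Delta>: "abstract_simplicial_complex (Pow A \<union> Pow B)"
    using fin by (auto simp: abstract_simplicial_complex_def intro: finite_subset)
  obtain a b where ab: "a \<in> A" "b \<in> B" using ne by blast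
  have ab': "a \<notin> B" "b \<notin> A" "a \<noteq> b" using ab disj by auto
  \<comment> \<open>Points of \<open>nsphere 0\<close> are real sequences whose entry at
    \<open>0\<close> is \<open>1\<close> or \<open>-1\<close> and whose other entries vanish. The
    map \<open>f\<close> takes the value \<open>1\<close> there on the simplex of \<open>A\<close>
    and \<open>-1\<close> on that of \<open>B\<close>.\<close>
  define f :: "('a \<Rightarrow> real) \<Rightarrow> nat \<Rightarrow> real"
    where "f x i = (if i = 0 then sum x A - sum x B else 0)" for x i
  \<comment> \<open>This affine formula sends \<open>1\<close> to the vertex \<open>a\<close> and
    \<open>-1\<close> to the vertex \<open>b\<close>, and makes continuity immediate.\<close>
  define g :: "(nat \<Rightarrow> real) \<Rightarrow> 'a \<Rightarrow> real"
    where "g y v = (1 + y 0) / 2 * indicat_real {a} v + (1 - y 0) / 2 * indicat_real {b} v" for y v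
  have X: "(\<forall>v. v \<notin> A \<longrightarrow> x v = 0) \<and> sum x A = 1 \<and> sum x B = 0 \<or>
      (\<forall>v. v \<notin> B \<longrightarrow> x v = 0) \<and> sum x A = 0 \<and> sum x B = 1"
    if x: "x \<in> topspace ?X" for x
  proof -
    obtain \<sigma> where \<sigma>: "\<sigma> \<subseteq> A \<or> \<sigma> \<subseteq> B" "\<forall>v. v \<notin> \<sigma> \<longrightarrow> x v = 0" "sum x \<sigma> = 1"
      using x unfolding topspace_geometric_realization[OF \<Delta>] by auto
    have sum: "sum x C = 1 \<and> sum x D = 0" if "\<sigma> \<subseteq> C" "finite C" "C \<inter> D = {}" for C D
    proof
      show "sum x C = 1"
        using \<sigma>(2,3) that sum.mono_neutral_left[of C \<sigma> x] by auto
      show "sum x D = 0"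
        using \<sigma>(2) that by (intro sum.neutral) blast
    qed
    from \<sigma>(1) show ?thesis
    proof
      assume "\<sigma> \<subseteq> A"
      then show ?thesis using sum[of A B] fin disj \<sigma>(2) by blast
    next
      assume "\<sigma> \<subseteq> B"
      then show ?thesis using sum[of B A] fin disj \<sigma>(2) by blast
    qed
  qed
  have S0: "topspace (nsphere 0) = {y. (y 0 = 1 \<or> y 0 = -1) \<and> (\<forall>i>0. y i = 0)}"
    by (auto simp: nsphere power2_eq_1_iff)
  have "continuous_map ?X (nsphere 0) f"
    unfolding nsphere
  proof (intro continuous_map_into_subtopology)
    show "continuous_map ?X (powertop_real UNIV) f"
      unfolding continuous_map_componentwise_UNIV f_def
      using fin by (auto intro!: continuous_intros)
    show "f \<in> topspace ?X \<rightarrow> {x. (\<Sum>i\<le>0. (x i)\<^sup>2) = 1 \<and> (\<forall>i>0. x i = 0)}"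
      using X by (fastforce simp: f_def)
  qed
  moreover have cg: "continuous_map (nsphere 0) ?X g"
  proof (rule continuous_map_into_geometric_realization)
    show "continuous_map (nsphere 0) euclideanreal (\<lambda>y. g y v)" for v
      unfolding g_def
      by (intro continuous_intros continuous_map_real_mult_right continuous_map_real_divide
          continuous_map_nsphere_projection) auto
    fix y assume "y \<in> topspace (nsphere 0)"
    then consider "y 0 = 1" | "y 0 = -1" by (auto simp: S0)
    then have "g y = indicat_real {a} \<or> g y = indicat_real {b}"
      by cases (auto simp: g_def)
    then show "g y \<in> topspace ?X"
      using ab vertex_in_geometric_realization[OF \<Delta>] by auto
  qed
  \<comment> \<open>On the simplex of \<open>A\<close> the composite is constantly the vertex
    \<open>a\<close>, so \<open>A\<close> is a common face; likewise \<open>B\<close> with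
    \<open>b\<close>.\<close>
  moreover have "homotopic_with (\<lambda>_. True) ?X ?X (g \<circ> f) id"
  proof (rule homotopic_with_common_face[OF \<Delta>])
    show "continuous_map ?X ?X (g \<circ> f)"
      using calculation by (rule continuous_map_compose)
    fix x assume "x \<in> topspace ?X"
    from X[OF this] show "\<exists>\<sigma>\<in>Pow A \<union> Pow B. \<forall>v. v \<notin> \<sigma> \<longrightarrow> (g \<circ> f) x v = 0 \<and> id x v = 0"
    proof
      assume "(\<forall>v. v \<notin> A \<longrightarrow> x v = 0) \<and> sum x A = 1 \<and> sum x B = 0"
      then show ?thesis using ab by (intro bexI[of _ A]) (auto simp: f_def g_def indicator_def)
    next
      assume "(\<forall>v. v \<notin> B \<longrightarrow> x v = 0) \<and> sum x A = 0 \<and> sum x B = 1"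
      then show ?thesis using ab by (intro bexI[of _ B]) (auto simp: f_def g_def indicator_def)
    qed
  qed auto
  moreover have "homotopic_with (\<lambda>_. True) (nsphere 0) (nsphere 0) (f \<circ> g) id"
  proof (rule homotopic_with_equal)
    show "continuous_map (nsphere 0) (nsphere 0) (f \<circ> g)"
      using cg \<open>continuous_map ?X (nsphere 0) f\<close> by (rule continuous_map_compose)
    fix y assume y: "y \<in> topspace (nsphere 0)"
    have sum_ind: "sum (indicat_real {c}) C = (if c \<in> C then 1 else 0)" if "finite C"
      for c :: 'a and C
      using that by (simp add: indicator_def of_bool_def)
    have "sum (g y) A = (1 + y 0) / 2" "sum (g y) B = (1 - y 0) / 2"
      using ab ab' unfolding g_def sum.distrib sum_distrib_left[symmetric] sum_ind[OF fin(1)] sum_ind[OF fin(2)]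
      by simp_all
    then show "(f \<circ> g) y = id y"
      using y by (auto simp: f_def S0 field_simps)
  qed auto
  ultimately show ?thesis
    unfolding homotopy_equivalent_space_def by blast
qed

section \<open>Independent sets of complete bipartite graphs and the four claims\<close>

section \<open>Complete bipartite graphs\<close>

lemma abstract_simplicial_complex_total_cut_complex:
  "finite (verts G) \<Longrightarrow> abstract_simplicial_complex (total_cut_complex k G)"
  unfolding abstract_simplicial_complex_def total_cut_complex_def
  by (auto intro: finite_subset finite_Diff)

lemma indep_set_complete_bipartite:
  assumes "verts G = U \<union> V" "U \<inter> V = {}" "arcs_ends G = U \<times> V \<union> V \<times> U"
  shows "indep_set G S \<longleftrightarrow> S \<subseteq> U \<or> S \<subseteq> V"
proof
  assume "indep_set G S"
  then have "S \<subseteq> U \<union> V" "\<And>u v. u \<in> S \<Longrightarrow> v \<in> S \<Longrightarrow> \<not> (u \<in> U \<and> v \<in> V)"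
    unfolding indep_set_def assms(1,3) by (simp, blast)
  then show "S \<subseteq> U \<or> S \<subseteq> V" by blast
next
  assume "S \<subseteq> U \<or> S \<subseteq> V"
  then show "indep_set G S"
    unfolding indep_set_def assms(1,3) using assms(2) by blast
qed

theorem theorem4p3:
  fixes G :: "('a, 'b) pre_digraph" and m n k :: nat
  assumes "1 \<le> m" and "m \<le> n" and "2 \<le> k"
    and "complete_bipartite_digraph m n G"
  shows "(shellable (total_cut_complex k G) \<longleftrightarrow> m < k)
    \<and> (m < k \<and> k \<le> n \<longrightarrow> contractible_complex (total_cut_complex k G))
    \<and> (m = k \<and> k = n \<longrightarrow>
         geometric_realization (total_cut_complex k G) homotopy_equivalent_space nsphere 0)
    \<and> (n < k \<longrightarrow> total_cut_complex k G = {} \<and> shellable (total_cut_complex k G))"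
proof -
  let ?W = "verts G" and ?\<Delta> = "total_cut_complex k G"
  obtain U V where UV: "?W = U \<union> V" "U \<inter> V = {}" "card U = m" "card V = n"
      "arcs_ends G = U \<times> V \<union> V \<times> U" and "graph G"
    using assms(4) unfolding complete_bipartite_digraph_def by blast
  interpret graph G by fact
  have finW: "finite ?W" by simp
  have fin: "finite U" "finite V" using finW UV(1) by auto
  note indep = indep_set_complete_bipartite[OF UV(1,2,5)]
  have facets: "facets ?\<Delta> = {?W - S | S. (S \<subseteq> U \<or> S \<subseteq> V) \<and> card S = k}"
    by (simp add: facets_total_cut_complex indep)
  have no_U: "\<not> (S \<subseteq> U \<and> card S = k)" if "m < k" for S
    using that UV(3) fin(1) card_mono by (metis leD)
  have no_V: "\<not> (S \<subseteq> V \<and> card S = k)" if "n < k" for S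
    using that UV(4) fin(2) card_mono by (metis leD)
  have void: "?\<Delta> = {}" if "n < k"
    using no_U no_V assms(2) that unfolding total_cut_complex_def indep by auto
  have "shellable ?\<Delta>" if "m < k"
  proof (rule shellable_complements_of_subsets)
    show "facets ?\<Delta> = {?W - S | S. S \<subseteq> V \<and> card S = k}"
      unfolding facets using no_U[OF that] by blast
  qed (use finW UV(1) in auto)
  \<comment> \<open>Here \<open>k \<le> m \<le> n\<close>, so both parts contain
    \<open>k\<close>-subsets.\<close>
  moreover have "\<not> shellable ?\<Delta>" if "\<not> m < k"
    using not_shellable_disjoint_complements[OF finW assms(3) UV(2) _ _ _ _ facets]
      UV(1,3,4) assms(2) that by simp
  moreover have "contractible_complex ?\<Delta>" if mk: "m < k" "k \<le> n"
  proof -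
    \<comment> \<open>Every removed set lies in \<open>V\<close>, so any vertex of \<open>U\<close>
      belongs to all facets and serves as apex.\<close>
    obtain u where u: "u \<in> U" using assms(1) UV(3) by fastforce
    have \<Delta>: "?\<Delta> = (\<Union>S\<in>{S. S \<subseteq> V \<and> card S = k}. Pow (?W - S))"
      unfolding total_cut_complex_def indep using no_U[OF mk(1)] by blast
    obtain S where S: "S \<subseteq> V" "card S = k"
      using mk(2) UV(4) by (metis obtain_subset_with_card_n)
    show ?thesis
    proof (rule contractible_complex_cone[OF abstract_simplicial_complex_total_cut_complex[OF finW]])
      show "?\<Delta> \<noteq> {}" unfolding \<Delta> using S by blast
      show "insert u \<sigma> \<in> ?\<Delta>" if "\<sigma> \<in> ?\<Delta>" for \<sigma>
        using that u UV(1,2) unfolding \<Delta> by blast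
    qed
  qed
  moreover have "geometric_realization ?\<Delta> homotopy_equivalent_space nsphere 0"
    if mk: "m = k" "k = n"
  proof -
    \<comment> \<open>A subset of a part with as many elements as the part is the whole part; the
      complement of each part is the other one.\<close>
    have "{S. (S \<subseteq> U \<or> S \<subseteq> V) \<and> card S = k} = {U, V}"
      using card_subset_eq[OF fin(1)] card_subset_eq[OF fin(2)] UV(3,4) mk by auto
    then have "?\<Delta> = Pow (?W - U) \<union> Pow (?W - V)"
      unfolding total_cut_complex_def indep by simp
    also have "\<dots> = Pow V \<union> Pow U"
      using UV(1,2) by blast
    finally have \<Delta>: "?\<Delta> = Pow V \<union> Pow U" .
    have "V \<noteq> {}" "U \<noteq> {}" "V \<inter> U = {}" using UV(2-4) assms(1,2) by auto
    then show ?thesis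
      unfolding \<Delta> using disjoint_simplices_homotopy_equivalent_nsphere_0[OF fin(2,1)] by blast
  qed
  ultimately show ?thesis
    using void shellable_void by auto
qed

end
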